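(* For every integer $n\ge0$ let $$P_n=P_n(q)=\sum_{j\ge0}\sum_{k\ge0}q^{j^2+2j+k^2}\begin{bmatrix} j\\ k\end{bmatrix}_{q^2}\begin{bmatrix} n+j-k+1\\ 2j+1\end{bmatrix}_{q}.$$ Then $$P_n=\sum_{j=-\infty}^\infty(-1)^jq^{6j^2+4j}\begin{bmatrix} 2n+2\\ n+3j+2\end{bmatrix}_{q}=\sum_{j=-\infty}^\infty q^{12j^2+6j}\,U(n+1,6j+1;q),$$ and $P_0=1$, $P_1=q^3+q+1$, and $P_n=(1+q+q^{2n+1})P_{n-1}+(q^{2n}-q)P_{n-2}$ for $n\ge2$.
   Context: $q$ is an indeterminate. $(a;p)_n=\prod_{i=0}^{n-1}(1-ap^i)$. The Gaussian polynomial in base $p$ is $\begin{bmatrix} A\\ B\end{bmatrix}_{p}=\frac{(p;p)_A}{(p;p)_B(p;p)_{A-B}}$ if $0\le B\le A$, and $0$ otherwise. For integers $L\ge0$ and $A$, $$T_0(L,A;q)=\sum_{r=0}^L(-1)^r\begin{bmatrix} L\\ r\end{bmatrix}_{q^2}\begin{bmatrix} 2L-2r\\ L-A-r\end{bmatrix}_{q},\qquad U(L,A;q)=T_0(L,A;q)+T_0(L,A+1;q).$$ All sums have only finitely many nonzero terms. *)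

theory Defs
  imports
    "HOL-Computational_Algebra.Computational_Algebra"
    "HOL-Library.Groups_Big_Fun"
begin

text \<open>
  The indeterminate lives in the field \<open>\<rat>(q)\<close>, the fraction field of \<open>\<int>[q]\<close>, so that the quotient
  defining a Gaussian polynomial is a genuine one: \<open>(p;p)\<^sub>n\<close> is nonzero for \<open>p = q\<close> and \<open>p = q\<^sup>2\<close>.
\<close>

definition q :: "int poly fract" where
  "q = Fract [:0, 1:] 1"

definition qpoch :: "'a::comm_ring_1 \<Rightarrow> 'a \<Rightarrow> nat \<Rightarrow> 'a" where
  "qpoch a p n = (\<Prod>i<n. 1 - a * p ^ i)"

definition gauss_poly :: "'a::field \<Rightarrow> int \<Rightarrow> int \<Rightarrow> 'a" where
  "gauss_poly p A B =
     (if 0 \<le> B \<and> B \<le> A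
      then qpoch p p (nat A) / (qpoch p p (nat B) * qpoch p p (nat (A - B)))
      else 0)"

definition T0 :: "'a::field \<Rightarrow> nat \<Rightarrow> int \<Rightarrow> 'a" where
  "T0 x L A = (\<Sum>r=0..L. (-1) ^ r * gauss_poly (x ^ 2) (int L) (int r)
                 * gauss_poly x (2 * int L - 2 * int r) (int L - A - int r))"

definition U :: "'a::field \<Rightarrow> nat \<Rightarrow> int \<Rightarrow> 'a" where
  "U x L A = T0 x L A + T0 x L (A + 1)"

text \<open>
  \<^const>\<open>Sum_any\<close> sums over the support of its argument and is 0 if that support is infinite;
  the lemmas below show that the supports in question are finite.
\<close>

definition P :: "nat \<Rightarrow> int poly fract" where
  "P n = Sum_any (\<lambda>j::nat. Sum_any (\<lambda>k::nat. q ^ (j ^ 2 + 2 * j + k ^ 2)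
            * gauss_poly (q ^ 2) (int j) (int k)
            * gauss_poly q (int n + int j - int k + 1) (2 * int j + 1)))"

lemma finite_support_P_inner:
  "finite {k::nat. q ^ (j ^ 2 + 2 * j + k ^ 2) * gauss_poly (q ^ 2) (int j) (int k)
     * gauss_poly q (int n + int j - int k + 1) (2 * int j + 1) \<noteq> 0}"
  by (rule finite_subset[of _ "{..j}"]) (auto simp: gauss_poly_def split: if_splits)

lemma finite_support_P_outer:
  "finite {j::nat. Sum_any (\<lambda>k::nat. q ^ (j ^ 2 + 2 * j + k ^ 2)
     * gauss_poly (q ^ 2) (int j) (int k)
     * gauss_poly q (int n + int j - int k + 1) (2 * int j + 1)) \<noteq> 0}"
proof (rule finite_subset[of _ "{..n}"])
  have "Sum_any (\<lambda>k::nat. q ^ (j ^ 2 + 2 * j + k ^ 2) * gauss_poly (q ^ 2) (int j) (int k)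
     * gauss_poly q (int n + int j - int k + 1) (2 * int j + 1)) = 0" if "j > n" for j
    using that by (simp add: gauss_poly_def)
  then show "{j::nat. Sum_any (\<lambda>k::nat. q ^ (j ^ 2 + 2 * j + k ^ 2)
     * gauss_poly (q ^ 2) (int j) (int k)
     * gauss_poly q (int n + int j - int k + 1) (2 * int j + 1)) \<noteq> 0} \<subseteq> {..n}"
    using not_less by blast
qed simp

lemma finite_support_gauss:
  "finite {j::int. (-1) powi j * q powi (6 * j ^ 2 + 4 * j)
     * gauss_poly q (2 * int n + 2) (int n + 3 * j + 2) \<noteq> 0}"
  by (rule finite_subset[of _ "{- int n - 2..int n}"])
     (auto simp: gauss_poly_def split: if_splits)

lemma T0_eq_0:
  assumes "\<bar>A\<bar> > int L"
  shows "T0 x L A = 0"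
  using assms by (auto simp: T0_def gauss_poly_def intro!: sum.neutral)

lemma finite_support_U:
  "finite {j::int. q powi (12 * j ^ 2 + 6 * j) * U q (n + 1) (6 * j + 1) \<noteq> 0}"
proof (rule finite_subset[of _ "{- int n - 2..int n + 2}"])
  have "U q (n + 1) (6 * j + 1) = 0" if "j \<notin> {- int n - 2..int n + 2}" for j
    using that by (auto simp: U_def T0_eq_0)
  then show "{j::int. q powi (12 * j ^ 2 + 6 * j) * U q (n + 1) (6 * j + 1) \<noteq> 0}
      \<subseteq> {- int n - 2..int n + 2}"
    by (metis (mono_tags, lifting) mem_Collect_eq mult_zero_right subsetI)
qed simp

end

theory Submission
  imports Defs
begin

text \<open>
  The three expressions for \<open>P\<^sub>n\<close> are shown to obey the same second-order recurrence with the same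
  initial values.

  \<^emph>\<open>The double sum.\<close> Let \<open>P_row n j\<close> be its part with a fixed \<open>j\<close>, and write \<open>[n, B]\<close> for
  Gaussian polynomials. Since
  \<open>\<Sum>\<^sub>n [n, B] z\<^sup>n = z\<^sup>B / (z;q)\<^bsub>B+1\<^esub>\<close>, the \<open>q\<close>-binomial theorem gives, as power series in \<open>z\<close>,
  \<open>F\<^sub>j(z) = \<Sum>\<^sub>n P_row n j z\<^sup>n = q\<^bsup>j*j+2j\<^esup> z\<^sup>j (-zq;q\<^sup>2)\<^sub>j / (z;q)\<^bsub>2j+2\<^esub>\<close>. Hence
  \<open>(1-z)(1-qz) F\<^sub>j(z) = q\<^sup>3 z (1+qz) F\<^bsub>j-1\<^esub>(q\<^sup>2 z)\<close> for \<open>j \<ge> 1\<close>, while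
  \<open>(1-z)(1-qz) F\<^sub>0(z) = 1\<close>; summing over \<open>j\<close> yields the recurrence of the theorem. The proof below (\<open>P_row_rec\<close>) reads this off coefficientwise: \<open>(1-z)(1-qz)\<close> becomes
  \<open>gauss_second_difference\<close>.

  \<^emph>\<open>The two single sums.\<close> Write \<open>L = n + 1\<close>. Each single sum \<open>s\<^sub>L\<close> has a companion sum \<open>z\<^sub>L\<close> with
  \<open>s\<^bsub>L+1\<^esub> = (1 + q\<^bsup>2L+1\<^esup>) s\<^sub>L + q\<^sup>L z\<^sub>L\<close> and \<open>z\<^bsub>L+1\<^esub> = z\<^sub>L + 2 q\<^bsup>L+1\<^esup> s\<^sub>L\<close>, and in both cases
  \<open>s\<^sub>0 = 0\<close>, \<open>z\<^sub>0 = 1\<close>; so the sums agree, and eliminating \<open>z\<close> gives the recurrence of the theorem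
  (\<open>system_second_order\<close>).
  For the alternating sum of Gaussian polynomials (\<open>alt_sum_system\<close>) this follows from a two-step
  Pascal rule and a relation between neighbours (\<open>central_Suc\<close>, \<open>central_ratio\<close>) for central
  Gaussian polynomials: the reflections \<open>j \<mapsto> -j\<close> and \<open>j \<mapsto> -j-1\<close> preserve exponents of the form
  \<open>6j\<^sup>2 + tj\<close> up to a constant, and so identify the terms that arise. For the sum over \<open>U\<close>
  (\<open>U_system\<close>) it follows from the Andrews--Baxter recurrences of the \<open>q\<close>-trinomial coefficients
  \<open>T\<^sub>0\<close>, \<open>T\<^sub>1\<close>, \<open>U\<close> (\<open>T1_Suc\<close>, \<open>U_Suc\<close>): weighted with \<open>q\<^bsup>12j*j+6j\<^esup>\<close>, the \<open>T\<^sub>1\<close>-terms of the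
  \<open>U\<close>-recurrence form the companion, and the same reflections turn the \<open>T\<^sub>0\<close>-terms
  of the \<open>T\<^sub>1\<close>-recurrence back into two copies of the sum over \<open>U\<close>.
\<close>

section \<open>Sums over the integers\<close>

lemma finite_support_affine:
  fixes m a :: int and c :: "int \<Rightarrow> 'a::mult_zero"
  assumes "finite {A. f A \<noteq> 0}" "m \<noteq> 0"
  shows "finite {j. c j * f (m * j + a) \<noteq> 0}"
proof (rule finite_subset)
  show "finite ((\<lambda>j. m * j + a) -` {A. f A \<noteq> 0})"
    using assms by (intro finite_vimageI) (auto simp: inj_def)
qed auto

lemma Sum_any_linear:
  fixes f g h :: "'b \<Rightarrow> 'a::comm_ring_1"
  assumes "finite {j. f j \<noteq> 0}" "finite {j. g j \<noteq> 0}" "finite {j. h j \<noteq> 0}"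
  shows "Sum_any (\<lambda>j. a * f j + b * g j + c * h j) = a * Sum_any f + b * Sum_any g + c * Sum_any h"
proof -
  let ?S = "{j. f j \<noteq> 0} \<union> {j. g j \<noteq> 0} \<union> {j. h j \<noteq> 0}"
  have S: "finite ?S" using assms by simp
  have "Sum_any (\<lambda>j. a * f j + b * g j + c * h j) = (\<Sum>j\<in>?S. a * f j + b * g j + c * h j)"
    by (rule Sum_any.expand_superset[OF S]) auto
  moreover have "Sum_any f = sum f ?S" "Sum_any g = sum g ?S" "Sum_any h = sum h ?S"
    by (rule Sum_any.expand_superset[OF S], blast)+
  ultimately show ?thesis by (simp add: sum.distrib sum_distrib_left)
qed

lemma bij_uminus_minus: "bij (\<lambda>j::int. - j - a)"
  by (rule bij_betw_byWitness[where f' = "\<lambda>j. - j - a"]) auto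

lemma Sum_any_flip: "Sum_any (\<lambda>j::int. f (- j - a)) = Sum_any f"
  by (rule sym, rule Sum_any.reindex_cong[OF bij_uminus_minus[of a]]) (simp add: o_def)

section \<open>Gaussian polynomials in a base that is not a root of unity\<close>

text \<open>
  Both \<open>q\<close> and \<open>q\<^sup>2\<close> occur as bases; as neither is a root of unity, no denominator \<open>(x;x)\<^sub>n\<close>
  vanishes.
\<close>
locale generic_base =
  fixes x :: "'a::field"
  assumes nonzero: "x \<noteq> 0"
    and power_neq_1: "\<And>n::nat. n > 0 \<Longrightarrow> x ^ n \<noteq> 1"
begin

lemma qpoch_Suc: "qpoch x x (Suc n) = qpoch x x n * (1 - x ^ Suc n)"
  by (simp add: qpoch_def)

lemma qpoch_nonzero: "qpoch x x n \<noteq> 0"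
  using power_neq_1[of "Suc _"] by (auto simp: qpoch_def)

lemma gauss_nat:
  "gauss_poly x (int (m + k)) (int k) = qpoch x x (m + k) / (qpoch x x k * qpoch x x m)"
  by (simp add: gauss_poly_def nat_add_distrib)

lemma gauss_eq_0: "B < 0 \<or> A < B \<Longrightarrow> gauss_poly x A B = 0"
  by (auto simp: gauss_poly_def)

lemma gauss_n_0: "A \<ge> 0 \<Longrightarrow> gauss_poly x A 0 = 1"
  by (simp add: gauss_poly_def qpoch_nonzero, simp add: qpoch_def)

lemma gauss_n_n: "A \<ge> 0 \<Longrightarrow> gauss_poly x A A = 1"
  by (simp add: gauss_poly_def qpoch_nonzero, simp add: qpoch_def)

lemma gauss_sym: "gauss_poly x A (A - B) = gauss_poly x A B"
  by (auto simp: gauss_poly_def mult.commute)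

text \<open>
  The bound \<open>A \<ge> 1\<close> excludes only the corner \<open>A = B = 0\<close>, where the left side is 1 and the right
  side is 0. The interior case rests on
  \<open>1 - x\<^bsup>k+m+2\<^esup> = (1 - x\<^bsup>k+1\<^esup>) + x\<^bsup>k+1\<^esup> (1 - x\<^bsup>m+1\<^esup>)\<close>.
\<close>
lemma gauss_pascal:
  assumes "A \<ge> 1"
  shows "gauss_poly x A B = gauss_poly x (A - 1) (B - 1) + x powi B * gauss_poly x (A - 1) B"
proof -
  consider "B < 0 \<or> A < B" | "B = 0" | "B = A" | "0 < B" "B < A" by linarith
  then show ?thesis
  proof cases
    case 1 then show ?thesis by (auto simp: gauss_eq_0)
  next
    case 2 then show ?thesis using assms by (simp add: gauss_n_0 gauss_eq_0)
  next
    case 3 then show ?thesis using assms by (simp add: gauss_n_n gauss_eq_0)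
  next
    case 4
    define k where "k = nat (B - 1)"
    define m where "m = nat (A - B - 1)"
    have B: "B = int (Suc k)" and A: "A = int (Suc m + Suc k)"
      using 4 by (auto simp: k_def m_def)
    have e1: "gauss_poly x A B = qpoch x x (Suc (Suc (m + k))) / (qpoch x x (Suc k) * qpoch x x (Suc m))"
      unfolding A B by (subst gauss_nat) simp
    have e2: "gauss_poly x (A - 1) (B - 1) = qpoch x x (Suc (m + k)) / (qpoch x x k * qpoch x x (Suc m))"
      using gauss_nat[of "Suc m" k] by (simp add: A B algebra_simps)
    have e3: "gauss_poly x (A - 1) B = qpoch x x (Suc (m + k)) / (qpoch x x (Suc k) * qpoch x x m)"
      using gauss_nat[of m "Suc k"] by (simp add: A B algebra_simps)
    have p: "x powi B = x ^ Suc k" unfolding B by (rule power_int_of_nat)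
    have nz: "1 - x ^ Suc k \<noteq> 0" "1 - x ^ Suc m \<noteq> 0"
      using power_neq_1[of "Suc k"] power_neq_1[of "Suc m"] by auto
    have "1 - x ^ Suc (Suc (m + k)) = (1 - x ^ Suc k) + x ^ Suc k * (1 - x ^ Suc m)"
      by (simp add: algebra_simps power_add)
    then show ?thesis
      unfolding e1 e2 e3 p qpoch_Suc[of "Suc (m + k)"] qpoch_Suc[of k] qpoch_Suc[of m]
      using nz qpoch_nonzero[of k] qpoch_nonzero[of m]
      by (simp add: divide_simps del: power_Suc) (simp add: algebra_simps del: power_Suc)
  qed
qed

lemma gauss_pascal':
  assumes "A \<ge> 1"
  shows "gauss_poly x A B = x powi (A - B) * gauss_poly x (A - 1) (B - 1) + gauss_poly x (A - 1) B"
  using gauss_pascal[OF assms, of "A - B"] gauss_sym[of A B]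
    gauss_sym[of "A - 1" B] gauss_sym[of "A - 1" "B - 1"]
  by (simp add: algebra_simps)

lemma gauss_absorb:
  assumes "A \<ge> 1"
  shows "(1 - x powi B) * gauss_poly x A B = (1 - x powi A) * gauss_poly x (A - 1) (B - 1)"
proof -
  have m: "x powi B * x powi (A - B) = x powi A"
    by (simp add: power_int_add[symmetric] nonzero)
  have "(1 - x powi B) * gauss_poly x A B
      = gauss_poly x (A - 1) (B - 1) + x powi B * gauss_poly x (A - 1) B
        - x powi B * (x powi (A - B) * gauss_poly x (A - 1) (B - 1) + gauss_poly x (A - 1) B)"
    using gauss_pascal[OF assms, of B] gauss_pascal'[OF assms, of B] by (simp add: left_diff_distrib)
  also have "\<dots> = gauss_poly x (A - 1) (B - 1)
      - (x powi B * x powi (A - B)) * gauss_poly x (A - 1) (B - 1)"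
    by (simp add: algebra_simps)
  finally show ?thesis unfolding m by (simp add: algebra_simps)
qed

lemma gauss_absorb':
  assumes "A \<ge> 1"
  shows "(1 - x powi (A - B)) * gauss_poly x A B = (1 - x powi A) * gauss_poly x (A - 1) B"
  using gauss_absorb[OF assms, of "A - B"] gauss_sym[of A B] gauss_sym[of "A - 1" B]
  by (simp add: algebra_simps)

text \<open>
  This is multiplication of \<open>z\<^sup>B / (z;x)\<^bsub>B+1\<^esub>\<close> by \<open>(1-z)(1-xz)\<close>: what remains,
  \<open>z\<^sup>B / (x\<^sup>2 z;x)\<^bsub>B-1\<^esub>\<close>, is \<open>z\<^sup>2\<close> times the same series for \<open>B - 2\<close>, up to a power of \<open>x\<close>, in the
  variable \<open>x\<^sup>2 z\<close>.
\<close>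
lemma gauss_second_difference:
  assumes "m \<ge> 2"
  shows "gauss_poly x m B - (1 + x) * gauss_poly x (m - 1) B + x * gauss_poly x (m - 2) B
    = x powi (2 * (m - B)) * gauss_poly x (m - 2) (B - 2)"
proof -
  have e: "x powi (2 * (m - B)) = x powi (m - B) * x powi (m - B)"
    "x * x powi (m - 1 - B) = x powi (m - B)"
    using power_int_add[of x "m - B" "m - B"] power_int_add[of x 1 "m - 1 - B"]
    by (simp_all add: nonzero)
  have a: "gauss_poly x m B - gauss_poly x (m - 1) B = x powi (m - B) * gauss_poly x (m - 1) (B - 1)"
    using gauss_pascal'[of m B] assms by simp
  have b: "gauss_poly x (m - 1) B - gauss_poly x (m - 2) B
      = x powi (m - 1 - B) * gauss_poly x (m - 2) (B - 1)"
    using gauss_pascal'[of "m - 1" B] assms by simp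
  have c: "gauss_poly x (m - 1) (B - 1) - gauss_poly x (m - 2) (B - 1)
      = x powi (m - B) * gauss_poly x (m - 2) (B - 2)"
    using gauss_pascal'[of "m - 1" "B - 1"] assms by simp
  have "gauss_poly x m B - (1 + x) * gauss_poly x (m - 1) B + x * gauss_poly x (m - 2) B
     = (gauss_poly x m B - gauss_poly x (m - 1) B)
       - x * (gauss_poly x (m - 1) B - gauss_poly x (m - 2) B)"
    by (simp add: algebra_simps)
  also have "\<dots> = x powi (m - B) * gauss_poly x (m - 1) (B - 1)
      - (x * x powi (m - 1 - B)) * gauss_poly x (m - 2) (B - 1)"
    unfolding a b by (simp add: mult.assoc)
  also have "\<dots> = x powi (m - B) * (gauss_poly x (m - 1) (B - 1) - gauss_poly x (m - 2) (B - 1))"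
    unfolding e by (simp add: algebra_simps)
  finally show ?thesis unfolding c e by (simp add: mult.assoc)
qed

lemma generic_base_square: "generic_base (x ^ 2)"
  by unfold_locales (use nonzero power_neq_1[of "2 * _"] in \<open>auto simp flip: power_mult\<close>)

section \<open>Central Gaussian polynomials\<close>

text \<open>
  With entries indexed by the distance \<open>A\<close> from the middle, the symmetry of Gaussian polynomials
  is \<open>A \<mapsto> -A\<close>.
\<close>
definition central :: "nat \<Rightarrow> int \<Rightarrow> 'a" where
  "central M A = gauss_poly x (2 * int M) (int M - A)"

text \<open>
  The odd row \<open>2M + 1\<close> between two even ones. Comparing its two Pascal expansions
  \<open>near_central_left\<close> and \<open>near_central_right\<close> gives \<open>central_ratio\<close>.
\<close>
definition near_central :: "nat \<Rightarrow> int \<Rightarrow> 'a" where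
  "near_central M A = gauss_poly x (2 * int M + 1) (int M - A)"

lemma central_sym: "central M (- A) = central M A"
  using gauss_sym[of "2 * int M" "int M - A"] by (simp add: central_def algebra_simps)

lemma central_eq_0: "\<bar>A\<bar> > int M \<Longrightarrow> central M A = 0"
  by (auto simp: central_def intro!: gauss_eq_0)

lemma near_central_left:
  "near_central M A = central M (A + 1) + x powi (int M - A) * central M A"
  using gauss_pascal[of "2 * int M + 1" "int M - A"]
  by (simp add: near_central_def central_def algebra_simps)

lemma near_central_right:
  "near_central M A = x powi (int M + A + 1) * central M (A + 1) + central M A"
  using gauss_pascal'[of "2 * int M + 1" "int M - A"]
  by (simp add: near_central_def central_def algebra_simps)

text \<open>
  Two Pascal steps, with different rules on the two levels. This choice makes the result invariant
  under \<open>A \<mapsto> -A\<close> and its middle factor independent of \<open>A\<close>, so that the latter leaves sums over \<open>A\<close>.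
\<close>
lemma central_Suc:
  "central (Suc M) A = x powi (int M + 1 + A) * central M (A + 1)
     + (1 + x ^ (2 * M + 1)) * central M A + x powi (int M + 1 - A) * central M (A - 1)"
proof -
  have "central (Suc M) A = x powi (int M + 1 + A) * near_central M A + near_central M (A - 1)"
    using gauss_pascal'[of "2 * int (Suc M)" "int (Suc M) - A"]
    by (simp add: near_central_def central_def algebra_simps)
  moreover have "x powi (int M + 1 + A) * x powi (int M - A) = x ^ (2 * M + 1)"
  proof -
    have "x powi (int M + 1 + A) * x powi (int M - A) = x powi int (2 * M + 1)"
      by (simp add: power_int_add[symmetric] nonzero algebra_simps del: power_int_of_nat)
    then show ?thesis by (simp only: power_int_of_nat)
  qed
  ultimately show ?thesis
    using near_central_left[of M A] near_central_left[of M "A - 1"]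
    by (simp add: algebra_simps del: power_Suc)
qed

lemma central_ratio:
  "central M A - central M (A + 1)
     = x powi (int M - A) * central M A - x powi (int M + A + 1) * central M (A + 1)"
  using near_central_left[of M A] near_central_right[of M A] by (simp add: algebra_simps)

lemma central_absorb:
  "(1 - x powi (int (Suc M) + A + 1)) * central (Suc M) (A + 1)
     = (1 - x ^ (2 * Suc M)) * near_central M A"
  using gauss_absorb'[of "2 * int (Suc M)" "int (Suc M) - A - 1"]
    power_int_of_nat[of x "2 * Suc M"]
  by (simp add: near_central_def central_def algebra_simps del: power_int_of_nat power_Suc)

section \<open>Alternating convolutions in base \<open>x\<^sup>2\<close>\<close>

text \<open>
  The \<open>q\<close>-trinomial coefficients \<open>T\<^sub>0\<close> and \<open>T\<^sub>1\<close> are this transform of a column of central Gaussian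
  polynomials, with \<open>w = 1\<close> and \<open>w = x\<close>. Allowing every weight \<open>w\<close> lets the lemmas trade
  factors \<open>x\<^sup>r\<close> for a change of \<open>w\<close>, and hence pass between \<open>T\<^sub>0\<close> and \<open>T\<^sub>1\<close>.
\<close>
definition alt_conv :: "'a \<Rightarrow> nat \<Rightarrow> (nat \<Rightarrow> 'a) \<Rightarrow> 'a" where
  "alt_conv w L f = (\<Sum>r\<le>L. (- w) ^ r * gauss_poly (x ^ 2) (int L) (int r) * f (L - r))"

lemma alt_conv_0: "alt_conv w 0 f = f 0"
  using generic_base.gauss_n_0[OF generic_base_square, of 0] by (simp add: alt_conv_def)

lemma alt_conv_add: "alt_conv w L (\<lambda>M. f M + g M) = alt_conv w L f + alt_conv w L g"
  by (simp add: alt_conv_def algebra_simps sum.distrib)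

lemma alt_conv_diff: "alt_conv w L (\<lambda>M. f M - g M) = alt_conv w L f - alt_conv w L g"
  by (simp add: alt_conv_def algebra_simps sum_subtractf)

lemma alt_conv_scale: "alt_conv w L (\<lambda>M. c * f M) = c * alt_conv w L f"
  by (simp add: alt_conv_def sum_distrib_left mult_ac)

lemma alt_conv_power: "alt_conv (w * x) L (\<lambda>M. x ^ M * f M) = x ^ L * alt_conv w L f"
  unfolding alt_conv_def sum_distrib_left
proof (rule sum.cong[OF refl])
  fix r assume "r \<in> {..L}"
  then have "x ^ L = x ^ r * x ^ (L - r)" by (simp flip: power_add)
  moreover have "(- (w * x)) ^ r = (- w) ^ r * x ^ r"
    by (simp flip: power_mult_distrib)
  ultimately show "(- (w * x)) ^ r * gauss_poly (x\<^sup>2) (int L) (int r) * (x ^ (L - r) * f (L - r)) =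
         x ^ L * ((- w) ^ r * gauss_poly (x\<^sup>2) (int L) (int r) * f (L - r))"
    by (simp add: mult_ac)
qed

text \<open>
  The common pattern of the next four lemmas: a rule for Gaussian polynomials rewrites row \<open>L + 1\<close> in
  terms of the entries \<open>r\<close> and \<open>r - 1\<close> of row \<open>L\<close>, and the second family is reindexed by \<open>r + 1\<close>. The
  boundary terms \<open>r = L + 1\<close> and \<open>r = 0\<close> vanish.
\<close>
lemma alt_conv_split:
  assumes "\<And>r. r \<le> Suc L \<Longrightarrow> h r = g r * gauss_poly (x ^ 2) (int L) (int r)
      + k r * gauss_poly (x ^ 2) (int L) (int r - 1)"
  shows "(\<Sum>r\<le>Suc L. (- w) ^ r * h r)
    = (\<Sum>r\<le>L. (- w) ^ r * gauss_poly (x ^ 2) (int L) (int r) * g r)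
      - w * (\<Sum>r\<le>L. (- w) ^ r * gauss_poly (x ^ 2) (int L) (int r) * k (Suc r))"
proof -
  let ?G = "gauss_poly (x ^ 2) (int L)"
  note z = generic_base.gauss_eq_0[OF generic_base_square]
  have "(\<Sum>r\<le>Suc L. (- w) ^ r * h r)
      = (\<Sum>r\<le>Suc L. (- w) ^ r * ?G (int r) * g r) + (\<Sum>r\<le>Suc L. (- w) ^ r * ?G (int r - 1) * k r)"
    unfolding sum.distrib[symmetric]
    by (rule sum.cong[OF refl]) (simp add: assms algebra_simps del: power_Suc)
  moreover have "(\<Sum>r\<le>Suc L. (- w) ^ r * ?G (int r) * g r) = (\<Sum>r\<le>L. (- w) ^ r * ?G (int r) * g r)"
    by (simp add: z)
  moreover have "(\<Sum>r\<le>Suc L. (- w) ^ r * ?G (int r - 1) * k r)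
      = (\<Sum>r\<le>L. (- w) ^ Suc r * ?G (int r) * k (Suc r))"
    by (subst sum.atMost_Suc_shift) (simp add: z)
  moreover have "\<dots> = - w * (\<Sum>r\<le>L. (- w) ^ r * ?G (int r) * k (Suc r))"
    unfolding sum_distrib_left by (rule sum.cong[OF refl]) (simp add: mult_ac)
  ultimately show ?thesis by simp
qed

lemma alt_conv_pascal:
  "alt_conv w (Suc L) f
     = alt_conv (w * x ^ 2) L (\<lambda>M. f (Suc M)) - w * alt_conv w L f"
proof -
  have "alt_conv w (Suc L) f
     = (\<Sum>r\<le>Suc L. (- w) ^ r * (gauss_poly (x ^ 2) (int (Suc L)) (int r) * f (Suc L - r)))"
    by (simp only: alt_conv_def mult.assoc)
  also have "\<dots> = (\<Sum>r\<le>L. (- w) ^ r * gauss_poly (x ^ 2) (int L) (int r) * ((x ^ 2) ^ r * f (Suc L - r)))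
      - w * (\<Sum>r\<le>L. (- w) ^ r * gauss_poly (x ^ 2) (int L) (int r) * f (Suc L - Suc r))"
    using generic_base.gauss_pascal[OF generic_base_square, of "int (Suc L)" "int _"]
    by (intro alt_conv_split) (simp add: algebra_simps)
  also have "(\<Sum>r\<le>L. (- w) ^ r * gauss_poly (x ^ 2) (int L) (int r) * ((x ^ 2) ^ r * f (Suc L - r)))
      = alt_conv (w * x ^ 2) L (\<lambda>M. f (Suc M))"
    unfolding alt_conv_def
    by (rule sum.cong[OF refl]) (simp add: Suc_diff_le power_mult_distrib[of "- w" "x ^ 2", simplified] mult_ac)
  finally show ?thesis by (simp add: alt_conv_def)
qed

lemma alt_conv_pascal':
  "alt_conv w (Suc L) f
     = alt_conv w L (\<lambda>M. f (Suc M)) - w * alt_conv w L (\<lambda>M. x ^ (2 * M) * f M)"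
proof -
  have "alt_conv w (Suc L) f
     = (\<Sum>r\<le>Suc L. (- w) ^ r * (gauss_poly (x ^ 2) (int (Suc L)) (int r) * f (Suc L - r)))"
    by (simp only: alt_conv_def mult.assoc)
  also have "\<dots> = (\<Sum>r\<le>L. (- w) ^ r * gauss_poly (x ^ 2) (int L) (int r) * f (Suc L - r))
      - w * (\<Sum>r\<le>L. (- w) ^ r * gauss_poly (x ^ 2) (int L) (int r)
                * (x ^ (2 * (Suc L - Suc r)) * f (Suc L - Suc r)))"
  proof (rule alt_conv_split)
    fix r assume r: "r \<le> Suc L"
    have "(x ^ 2) powi (int (Suc L) - int r) = x ^ (2 * (Suc L - r))"
      using r power_int_of_nat[of "x ^ 2" "Suc L - r"] by (simp add: of_nat_diff power_mult)
    then show "gauss_poly (x\<^sup>2) (int (Suc L)) (int r) * f (Suc L - r) =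
         f (Suc L - r) * gauss_poly (x\<^sup>2) (int L) (int r) +
         x ^ (2 * (Suc L - r)) * f (Suc L - r) * gauss_poly (x\<^sup>2) (int L) (int r - 1)"
      using generic_base.gauss_pascal'[OF generic_base_square, of "int (Suc L)" "int r"]
      by (simp add: algebra_simps)
  qed
  finally show ?thesis by (simp add: alt_conv_def Suc_diff_le)
qed

lemma alt_conv_absorb:
  "alt_conv w (Suc L) f - alt_conv (w * x ^ 2) (Suc L) f
     = - w * (1 - x ^ (2 * Suc L)) * alt_conv w L f"
proof -
  have p: "(- (w * x\<^sup>2)) ^ r = (- w) ^ r * (x ^ 2) ^ r" for r
    by (simp flip: power_mult_distrib)
  have "alt_conv w (Suc L) f - alt_conv (w * x ^ 2) (Suc L) f
     = (\<Sum>r\<le>Suc L. (- w) ^ r * ((1 - (x ^ 2) ^ r) * gauss_poly (x ^ 2) (int (Suc L)) (int r) * f (Suc L - r)))"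
    unfolding alt_conv_def sum_subtractf[symmetric] p
    by (rule sum.cong[OF refl]) (simp add: algebra_simps)
  also have "\<dots> = (\<Sum>r\<le>L. (- w) ^ r * gauss_poly (x ^ 2) (int L) (int r) * 0)
      - w * (\<Sum>r\<le>L. (- w) ^ r * gauss_poly (x ^ 2) (int L) (int r)
                * ((1 - x ^ (2 * Suc L)) * f (Suc L - Suc r)))"
  proof (rule alt_conv_split)
    fix r :: nat
    have "(1 - (x ^ 2) ^ r) * gauss_poly (x ^ 2) (int (Suc L)) (int r)
        = (1 - x ^ (2 * Suc L)) * gauss_poly (x ^ 2) (int L) (int r - 1)"
      using generic_base.gauss_absorb[OF generic_base_square, of "int (Suc L)" "int r"]
      by (simp only: power_int_of_nat power_mult) simp
    then show "(1 - (x ^ 2) ^ r) * gauss_poly (x ^ 2) (int (Suc L)) (int r) * f (Suc L - r)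
        = 0 * gauss_poly (x ^ 2) (int L) (int r)
          + (1 - x ^ (2 * Suc L)) * f (Suc L - r) * gauss_poly (x ^ 2) (int L) (int r - 1)"
      by (simp only: mult_ac mult_zero_left mult_zero_right add_0_left)
  qed
  also have "(\<Sum>r\<le>L. (- w) ^ r * gauss_poly (x ^ 2) (int L) (int r)
                * ((1 - x ^ (2 * Suc L)) * f (Suc L - Suc r)))
      = (1 - x ^ (2 * Suc L)) * alt_conv w L f"
    unfolding alt_conv_def sum_distrib_left by (rule sum.cong) (simp_all add: mult_ac)
  finally show ?thesis by (simp del: power_Suc mult_Suc_right)
qed

lemma alt_conv_absorb':
  "alt_conv w (Suc L) (\<lambda>M. (1 - x ^ (2 * M)) * f M)
     = (1 - x ^ (2 * Suc L)) * alt_conv w L (\<lambda>M. f (Suc M))"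
proof -
  have "alt_conv w (Suc L) (\<lambda>M. (1 - x ^ (2 * M)) * f M)
     = (\<Sum>r\<le>Suc L. (- w) ^ r * (gauss_poly (x ^ 2) (int (Suc L)) (int r) 
           * ((1 - x ^ (2 * (Suc L - r))) * f (Suc L - r))))"
    by (simp only: alt_conv_def mult.assoc)
  also have "\<dots> = (\<Sum>r\<le>L. (- w) ^ r * gauss_poly (x ^ 2) (int L) (int r) * ((1 - x ^ (2 * Suc L)) * f (Suc L - r)))
      - w * (\<Sum>r\<le>L. (- w) ^ r * gauss_poly (x ^ 2) (int L) (int r) * 0)"
  proof (rule alt_conv_split)
    fix r assume r: "r \<le> Suc L"
    have "(x ^ 2) powi (int (Suc L) - int r) = x ^ (2 * (Suc L - r))"
      using r power_int_of_nat[of "x ^ 2" "Suc L - r"] by (simp add: of_nat_diff power_mult)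
    moreover have "(x ^ 2) powi (int (Suc L)) = x ^ (2 * Suc L)"
      by (simp only: power_int_of_nat power_mult)
    ultimately have "(1 - x ^ (2 * (Suc L - r))) * gauss_poly (x ^ 2) (int (Suc L)) (int r)
        = (1 - x ^ (2 * Suc L)) * gauss_poly (x ^ 2) (int L) (int r)"
      using generic_base.gauss_absorb'[OF generic_base_square, of "int (Suc L)" "int r"]
      by simp
    then have "((1 - x ^ (2 * (Suc L - r))) * gauss_poly (x ^ 2) (int (Suc L)) (int r)) * f (Suc L - r)
        = ((1 - x ^ (2 * Suc L)) * gauss_poly (x ^ 2) (int L) (int r)) * f (Suc L - r)"
      by (rule arg_cong)
    then show "gauss_poly (x\<^sup>2) (int (Suc L)) (int r) * ((1 - x ^ (2 * (Suc L - r))) * f (Suc L - r)) =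
         (1 - x ^ (2 * Suc L)) * f (Suc L - r) * gauss_poly (x\<^sup>2) (int L) (int r) +
         0 * gauss_poly (x\<^sup>2) (int L) (int r - 1)"
      by (simp only: mult_ac mult_zero_left mult_zero_right add_0_right)
  qed
  finally show ?thesis by (simp add: alt_conv_def sum_distrib_left mult_ac Suc_diff_le)
qed


lemma powi_split: "x powi (int M + k) = x ^ M * x powi k"
  by (simp add: power_int_add nonzero)

section \<open>The Andrews--Baxter recurrences\<close>
definition T1 :: "nat \<Rightarrow> int \<Rightarrow> 'a" where
  "T1 L A = alt_conv x L (\<lambda>M. central M A)"

lemma T0_alt_conv: "T0 x L A = alt_conv 1 L (\<lambda>M. central M A)"
  unfolding T0_def alt_conv_def central_def atLeast0AtMost
  by (rule sum.cong) (auto simp: of_nat_diff algebra_simps)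

text \<open>
  Of the two Pascal rules for \<open>[L+1, r]\<close>, the one with factor \<open>x\<^bsup>2(L+1-r)\<^esup>\<close> on the second term is the
  right one: that term then cancels the summand \<open>x\<^bsup>2M+1\<^esup>\<close> in the middle factor of \<open>central_Suc\<close>.
\<close>
lemma T1_Suc:
  "T1 (Suc L) A = T1 L A
     + x ^ Suc L * (x powi A * T0 x L (A + 1) + x powi (- A) * T0 x L (A - 1))"
proof -
  have c: "central (Suc M) A = x ^ M * (x powi (1 + A) * central M (A + 1))
      + (central M A + x * (x ^ (2 * M) * central M A)) + x ^ M * (x powi (1 - A) * central M (A - 1))" for M
    using central_Suc[of M A] powi_split[of M "1 + A"] powi_split[of M "1 - A"]
    by (simp add: algebra_simps)
  have "T1 (Suc L) A = x ^ L * (x powi (1 + A) * T0 x L (A + 1)) + T1 L A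
      + x ^ L * (x powi (1 - A) * T0 x L (A - 1))"
    using alt_conv_power[of 1 L]
    unfolding T1_def alt_conv_pascal' c alt_conv_add T0_alt_conv by (simp add: alt_conv_scale)
  moreover have "x powi (1 + A) = x * x powi A" "x powi (1 - A) = x * x powi (- A)"
    using power_int_add[of x 1 A] power_int_add[of x 1 "- A"] nonzero by simp_all
  ultimately show ?thesis by (simp add: algebra_simps)
qed

text \<open>
  The difference of \<open>U\<close> and \<open>alt_conv 1 L\<close> of the odd rows comes, by \<open>central_absorb\<close>, with a factor
  \<open>1 - x\<^bsup>2M\<^esup>\<close>, whereas replacing the weight 1 by \<open>x\<^sup>2\<close> inserts \<open>1 - x\<^bsup>2r\<^esup>\<close>. With \<open>M = L - r\<close>,
  absorbing either factor into \<open>[L, r]\<close> leaves the same transform of level \<open>L - 1\<close>, so the two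
  corrections cancel.
\<close>
lemma alt_conv_near_central:
  "alt_conv (x ^ 2) L (\<lambda>M. near_central M A) = U x L A"
proof (cases L)
  case 0
  have "near_central 0 A = central 0 (A + 1) + central 0 A"
    by (cases "A = 0") (simp_all add: near_central_left central_eq_0)
  then show ?thesis by (simp add: 0 U_def T0_alt_conv alt_conv_0)
next
  case (Suc K)
  \<comment> \<open>At \<open>M = 0\<close> the truncated index is harmless: \<open>d 0\<close> is only used with the factor \<open>1 - x\<^sup>0 = 0\<close>.\<close>
  define d where "d M = near_central (M - 1) A" for M
  have ab: "(1 - x powi (int M + A + 1)) * central M (A + 1) = (1 - x ^ (2 * M)) * d M" for M
  proof (cases M)
    case 0
    then show ?thesis by (cases "A = - 1") (simp_all add: central_eq_0)
  qed (use central_absorb in \<open>simp add: d_def\<close>)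
  have c: "near_central M A = (central M A + central M (A + 1)) - (1 - x ^ (2 * M)) * d M" for M
    unfolding ab[symmetric] near_central_right by (simp add: algebra_simps)
  have "alt_conv 1 (Suc K) (\<lambda>M. near_central M A)
      = U x (Suc K) A - (1 - x ^ (2 * Suc K)) * alt_conv 1 K (\<lambda>M. d (Suc M))"
    unfolding U_def T0_alt_conv alt_conv_absorb'[symmetric] alt_conv_add[symmetric]
      alt_conv_diff[symmetric] c ..
  moreover have "alt_conv 1 (Suc K) (\<lambda>M. near_central M A) - alt_conv (1 * x ^ 2) (Suc K) (\<lambda>M. near_central M A)
      = - 1 * (1 - x ^ (2 * Suc K)) * alt_conv 1 K (\<lambda>M. near_central M A)"
    by (rule alt_conv_absorb)
  ultimately show ?thesis by (simp add: Suc d_def algebra_simps)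
qed

text \<open>
  Here the Pascal rule with factor \<open>x\<^bsup>2r\<^esup>\<close> is used, so that the weight becomes \<open>x\<^sup>2\<close> and
  the powers \<open>x\<^sup>M\<close> from \<open>central_Suc\<close> lower it to that of \<open>T\<^sub>1\<close>. The terms with index \<open>A\<close> and \<open>A + 1\<close>,
  apart from those with factor \<open>x\<^bsup>2M+1\<^esup>\<close>, combine to twice the odd row, that is to \<open>2 U\<close> by
  \<open>alt_conv_near_central\<close>; the second Pascal term takes away one of the two copies.
\<close>
lemma U_Suc:
  "U x (Suc L) A = (1 + x ^ (2 * L + 1)) * U x L A
     + x ^ L * (x powi (1 - A) * T1 L (A - 1) + x powi (A + 2) * T1 L (A + 2))"
proof -
  have c: "central (Suc M) A + central (Suc M) (A + 1)
     = x ^ M * (x powi (1 - A) * central M (A - 1) + x powi (A + 2) * central M (A + 2))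
      + (near_central M A + near_central M A
         + x * (x ^ M * (x ^ M * (central M A + central M (A + 1)))))" for M
  proof -
    have "x ^ (2 * M) = x ^ M * x ^ M" by (simp add: mult_2 power_add)
    then show ?thesis
    using central_Suc[of M A] central_Suc[of M "A + 1"] near_central_left[of M A] near_central_right[of M A]
      powi_split[of M "1 - A"] powi_split[of M "A + 2"]
    by (simp add: algebra_simps)
  qed
  have p2: "x ^ (2 * L + 1) = x * (x ^ L * x ^ L)" by (simp add: mult_2 power_add)
  have p: "alt_conv (x ^ 2) L (\<lambda>M. x ^ M * f M) = x ^ L * alt_conv x L f" for f
    using alt_conv_power[of x] by (simp add: power2_eq_square)
  have p': "alt_conv x L (\<lambda>M. x ^ M * f M) = x ^ L * alt_conv 1 L f" for f
    using alt_conv_power[of 1] by simp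
  have u: "alt_conv 1 L (\<lambda>M. central M A + central M (A + 1)) = U x L A"
    by (simp add: alt_conv_add U_def T0_alt_conv)
  have "U x (Suc L) A = alt_conv 1 (Suc L) (\<lambda>M. central M A + central M (A + 1))"
    by (simp add: alt_conv_add U_def T0_alt_conv)
  also have "\<dots> = alt_conv (x ^ 2) L (\<lambda>M. central (Suc M) A + central (Suc M) (A + 1)) - U x L A"
    unfolding alt_conv_pascal u by simp
  finally have "U x (Suc L) A
    = alt_conv (x ^ 2) L (\<lambda>M. central (Suc M) A + central (Suc M) (A + 1)) - U x L A" .
  moreover have "alt_conv (x ^ 2) L (\<lambda>M. central (Suc M) A + central (Suc M) (A + 1))
      = x ^ L * (x powi (1 - A) * T1 L (A - 1) + x powi (A + 2) * T1 L (A + 2))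
        + (2 * U x L A + x * (x ^ L * (x ^ L * U x L A)))"
    unfolding c
    by (simp only: alt_conv_add alt_conv_scale p p' T1_def alt_conv_near_central T0_alt_conv U_def mult_2)
  ultimately show ?thesis unfolding p2 by (simp add: algebra_simps)
qed

section \<open>The alternating sum\<close>

lemma finite_support_central: "finite {A. central L A \<noteq> 0}"
  by (rule finite_subset[of _ "{- int L..int L}"]) (use central_eq_0[of L] in force)+

lemma finite_support_T0: "finite {A. T0 x L A \<noteq> 0}"
  by (rule finite_subset[of _ "{- int L..int L}"]) (use T0_eq_0[of L] in force)+

lemma finite_support_T1: "finite {A. T1 L A \<noteq> 0}"
proof (rule finite_subset)
  have "T1 L A = 0" if "\<bar>A\<bar> > int L" for A
    unfolding T1_def alt_conv_def using that by (auto intro!: sum.neutral central_eq_0)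
  then show "{A. T1 L A \<noteq> 0} \<subseteq> {- int L..int L}" by force
qed simp

lemma T0_sym: "T0 x L (- A) = T0 x L A"
  by (simp add: T0_alt_conv central_sym)

text \<open>
  The sum in the theorem is \<open>alt_sum (n + 1) 1 4\<close>. The offset \<open>a\<close> and the linear exponent \<open>t\<close> are kept
  free because each Pascal step changes both.
\<close>
definition alt_sum :: "nat \<Rightarrow> int \<Rightarrow> int \<Rightarrow> 'a" where
  "alt_sum L a t = Sum_any (\<lambda>j. (-1) powi j * x powi (6 * j ^ 2 + t * j) * central L (3 * j + a))"

lemma finite_support_alt_sum:
  "finite {j. (-1) powi j * x powi (6 * j ^ 2 + t * j) * central L (3 * j + a) \<noteq> 0}"
  by (rule finite_support_affine[OF finite_support_central]) simp

lemma alt_sum_Suc: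
  "alt_sum (Suc L) a t = x powi (int L + 1 + a) * alt_sum L (a + 1) (t + 3)
     + (1 + x ^ (2 * L + 1)) * alt_sum L a t
     + x powi (int L + 1 - a) * alt_sum L (a - 1) (t - 3)"
proof -
  have "x powi (6 * j ^ 2 + t * j) * x powi (int L + 1 + (3 * j + a))
      = x powi (int L + 1 + a) * x powi (6 * j ^ 2 + (t + 3) * j)"
    "x powi (6 * j ^ 2 + t * j) * x powi (int L + 1 - (3 * j + a))
      = x powi (int L + 1 - a) * x powi (6 * j ^ 2 + (t - 3) * j)" for j
    by (simp_all add: power_int_add[symmetric] nonzero algebra_simps)
  note e = this[unfolded mult.commute[of "x powi (6 * _ ^ 2 + t * _)"]]
  have "(-1) powi j * x powi (6 * j ^ 2 + t * j) * central (Suc L) (3 * j + a)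
    = x powi (int L + 1 + a) * ((-1) powi j * x powi (6 * j ^ 2 + (t + 3) * j) * central L (3 * j + (a + 1)))
    + (1 + x ^ (2 * L + 1)) * ((-1) powi j * x powi (6 * j ^ 2 + t * j) * central L (3 * j + a))
    + x powi (int L + 1 - a) * ((-1) powi j * x powi (6 * j ^ 2 + (t - 3) * j) * central L (3 * j + (a - 1)))"
    for j
  proof -
    let ?s = "(-1) powi j :: 'a" and ?w = "x powi (6 * j ^ 2 + t * j)"
    let ?c = "central L (3 * j + (a + 1))" and ?d = "central L (3 * j + (a - 1))"
    have "?s * ?w * central (Suc L) (3 * j + a)
      = ?s * (x powi (int L + 1 + (3 * j + a)) * ?w) * ?c
        + (1 + x ^ (2 * L + 1)) * (?s * ?w * central L (3 * j + a))
        + ?s * (x powi (int L + 1 - (3 * j + a)) * ?w) * ?d"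
      unfolding central_Suc add.assoc[of "3 * j" a, symmetric] add_diff_eq
      by (simp only: distrib_left distrib_right mult_1_left mult_ac)
    then show ?thesis unfolding e by (simp only: mult_ac)
  qed
  then show ?thesis
    unfolding alt_sum_def by (simp only: Sum_any_linear[OF finite_support_alt_sum finite_support_alt_sum finite_support_alt_sum])
qed

lemma alt_sum_ratio:
  "alt_sum L a t = alt_sum L (a + 1) t + x powi (int L - a) * alt_sum L a (t - 3)
     - x powi (int L + a + 1) * alt_sum L (a + 1) (t + 3)"
proof -
  have "x powi (6 * j ^ 2 + t * j) * x powi (int L + (3 * j + a) + 1)
      = x powi (int L + a + 1) * x powi (6 * j ^ 2 + (t + 3) * j)"
    "x powi (6 * j ^ 2 + t * j) * x powi (int L - (3 * j + a))
      = x powi (int L - a) * x powi (6 * j ^ 2 + (t - 3) * j)" for j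
    by (simp_all add: power_int_add[symmetric] nonzero algebra_simps)
  note e = this[unfolded mult.commute[of "x powi (6 * _ ^ 2 + t * _)"]]
  have "(-1) powi j * x powi (6 * j ^ 2 + t * j) * central L (3 * j + a)
    = 1 * ((-1) powi j * x powi (6 * j ^ 2 + t * j) * central L (3 * j + (a + 1)))
    + x powi (int L - a) * ((-1) powi j * x powi (6 * j ^ 2 + (t - 3) * j) * central L (3 * j + a))
    + (- (x powi (int L + a + 1))) * ((-1) powi j * x powi (6 * j ^ 2 + (t + 3) * j) * central L (3 * j + (a + 1)))"
    for j
  proof -
    let ?s = "(-1) powi j :: 'a" and ?w = "x powi (6 * j ^ 2 + t * j)"
    let ?c = "central L (3 * j + (a + 1))" and ?d = "central L (3 * j + a)"
    have d: "?d = ?c + x powi (int L - (3 * j + a)) * ?d - x powi (int L + (3 * j + a) + 1) * ?c"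
      using central_ratio[of L "3 * j + a"] by (simp add: algebra_simps)
    have "?s * ?w * ?d
      = ?s * ?w * ?c + ?s * (x powi (int L - (3 * j + a)) * ?w) * ?d
        - ?s * (x powi (int L + (3 * j + a) + 1) * ?w) * ?c"
      by (subst d) (simp only: distrib_left right_diff_distrib mult_ac)
    then show ?thesis unfolding e by (simp only: mult_ac mult_1_left mult_minus_left mult_minus_right diff_conv_add_uminus)
  qed
  then show ?thesis
    unfolding alt_sum_def
    by (simp only: Sum_any_linear[OF finite_support_alt_sum finite_support_alt_sum finite_support_alt_sum]) simp
qed

lemma alt_sum_reflect: "alt_sum L (- a) (- t) = alt_sum L a t"
proof -
  have "alt_sum L a t = Sum_any (\<lambda>j. (-1) powi (- j - 0) * x powi (6 * (- j - 0) ^ 2 + t * (- j - 0))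
      * central L (3 * (- j - 0) + a))"
    unfolding alt_sum_def by (rule Sum_any_flip[symmetric])
  also have "\<dots> = alt_sum L (- a) (- t)"
    unfolding alt_sum_def
    by (rule Sum_any.cong) (use central_sym[of L "3 * _ + - a"] in \<open>simp add: power_int_minus_one_minus\<close>)
  finally show ?thesis ..
qed

text \<open>
  Substitute \<open>j \<mapsto> -j-1\<close>. The odd shift of \<open>j\<close> is what produces the sign.
\<close>
lemma alt_sum_flip: "alt_sum L a t = - (x powi (6 - t)) * alt_sum L (3 - a) (12 - t)"
proof -
  have "alt_sum L a t = Sum_any (\<lambda>j. (-1) powi (- j - 1) * x powi (6 * (- j - 1) ^ 2 + t * (- j - 1))
      * central L (3 * (- j - 1) + a))"
    unfolding alt_sum_def by (rule Sum_any_flip[symmetric])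
  also have "\<dots> = Sum_any (\<lambda>j. - (x powi (6 - t))
      * ((-1) powi j * x powi (6 * j ^ 2 + (12 - t) * j) * central L (3 * j + (3 - a))))"
  proof (rule Sum_any.cong)
    fix j
    have "x powi (6 * (- j - 1) ^ 2 + t * (- j - 1)) = x powi (6 - t) * x powi (6 * j ^ 2 + (12 - t) * j)"
      by (simp add: power_int_add[symmetric] nonzero algebra_simps power2_eq_square)
    moreover have "(-1 :: 'a) powi (- j - 1) = - ((-1) powi j)"
      by (simp add: power_int_diff power_int_minus_one_minus)
    moreover have "central L (3 * (- j - 1) + a) = central L (3 * j + (3 - a))"
      using central_sym[of L "3 * j + (3 - a)"] by (simp add: algebra_simps)
    ultimately show "(-1) powi (- j - 1) * x powi (6 * (- j - 1) ^ 2 + t * (- j - 1)) * central L (3 * (- j - 1) + a)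
      = - (x powi (6 - t)) * ((-1) powi j * x powi (6 * j ^ 2 + (12 - t) * j) * central L (3 * j + (3 - a)))"
      by simp
  qed
  also have "\<dots> = - (x powi (6 - t)) * alt_sum L (3 - a) (12 - t)"
    unfolding alt_sum_def by (rule Sum_any_right_distrib[OF finite_support_alt_sum, symmetric])
  finally show ?thesis .
qed

text \<open>
  This is the coefficient of \<open>x\<^sup>L\<close> when \<open>alt_sum_Suc\<close> is applied to \<open>alt_sum (L + 1) 1 4\<close> and the
  term with offset 2 is flipped back to offset 1.
\<close>
definition alt_companion :: "nat \<Rightarrow> 'a" where
  "alt_companion L = alt_sum L 0 1 - x * alt_sum L 1 5"

text \<open>
  The second equation needs one fact beyond the Pascal rule and the reflections: expanding the
  companion produces \<open>alt_sum L 0 2 - alt_sum L 1 2\<close>, which by \<open>alt_sum_ratio\<close> is \<open>x\<^sup>L\<close> times the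
  companion itself. This cancels the excess \<open>x\<^bsup>2L+1\<^esup>\<close> in its factor.
\<close>
lemma alt_sum_system:
  "alt_sum (Suc L) 1 4 = (1 + x ^ (2 * L + 1)) * alt_sum L 1 4 + x ^ L * alt_companion L"
  "alt_companion (Suc L) = alt_companion L + 2 * x ^ Suc L * alt_sum L 1 4"
proof -
  have p: "x powi (int L + 2) = x ^ L * x ^ 2" "x powi (int L + 1) = x ^ L * x" "x powi int L = x ^ L"
    using powi_split[of L 2] powi_split[of L 1] by simp_all
  have f7: "x * alt_sum L 2 7 = - alt_sum L 1 5"
    using alt_sum_flip[of L 2 7] nonzero by (simp add: power_int_minus)
  have f8: "x ^ 2 * alt_sum L 2 8 = - alt_sum L 1 4"
    using alt_sum_flip[of L 2 8] nonzero by (simp add: power_int_minus)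
  have "alt_sum (Suc L) 1 4 = x ^ L * (x * (x * alt_sum L 2 7)) + (1 + x ^ (2 * L + 1)) * alt_sum L 1 4
     + x ^ L * alt_sum L 0 1"
    using alt_sum_Suc[of L 1 4] p by (simp add: power2_eq_square mult.assoc add.assoc)
  then show "alt_sum (Suc L) 1 4 = (1 + x ^ (2 * L + 1)) * alt_sum L 1 4 + x ^ L * alt_companion L"
    unfolding f7 by (simp add: alt_companion_def algebra_simps)
  have r0: "alt_sum L 0 (-1) = alt_sum L 0 1" and r1: "alt_sum L (-1) (-2) = alt_sum L 1 2"
    using alt_sum_reflect[of L 0 1] alt_sum_reflect[of L 1 2] by simp_all
  have c: "alt_sum L 0 2 - alt_sum L 1 2 = x ^ L * alt_companion L"
    using alt_sum_ratio[of L 0 2] p by (simp add: r0 alt_companion_def algebra_simps)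
  have h0: "alt_sum (Suc L) 0 1 = x ^ L * x * alt_sum L 1 4 + (1 + x ^ (2 * L + 1)) * alt_sum L 0 1
     + x ^ L * x * alt_sum L 1 2"
    using alt_sum_Suc[of L 0 1] p by (simp add: r1)
  have h1: "alt_sum (Suc L) 1 5 = (1 + x ^ (2 * L + 1)) * alt_sum L 1 5
     + x ^ L * alt_sum L 0 2 - x ^ L * alt_sum L 1 4"
    using alt_sum_Suc[of L 1 5] p f8 by (simp add: mult.assoc add.assoc)
  have "alt_companion (Suc L)
      = 2 * x ^ Suc L * alt_sum L 1 4 + (1 + x ^ (2 * L + 1)) * alt_companion L
        - x ^ Suc L * (alt_sum L 0 2 - alt_sum L 1 2)"
    unfolding alt_companion_def h0 h1 by (simp add: algebra_simps)
  moreover have "x ^ (2 * L + 1) = x ^ Suc L * x ^ L" by (simp add: mult_2 power_add)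
  ultimately show "alt_companion (Suc L) = alt_companion L + 2 * x ^ Suc L * alt_sum L 1 4"
    unfolding c by (simp only: distrib_right mult_1_left mult.assoc) simp
qed

section \<open>The sum over \<open>U\<close>\<close>
definition U_sum :: "nat \<Rightarrow> 'a" where
  "U_sum L = Sum_any (\<lambda>j. x powi (12 * j ^ 2 + 6 * j) * U x L (6 * j + 1))"

text \<open>
  Equivalently \<open>\<Sum>\<^sub>i x\<^bsup>3i*i\<^esup> T\<^sub>1(L, 3i)\<close>, split into even \<open>i = 2j\<close> and odd \<open>i = 2j + 1\<close>; the split form
  is the one that arises from \<open>U_Suc\<close> with \<open>A = 6j + 1\<close>.
\<close>
definition U_companion :: "nat \<Rightarrow> 'a" where
  "U_companion L = Sum_any (\<lambda>j. x powi (12 * j ^ 2) * T1 L (6 * j)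
      + x powi (12 * j ^ 2 + 12 * j + 3) * T1 L (6 * j + 3))"

lemma finite_support_weighted_T0: "finite {j. c j * T0 x L (6 * j + a) \<noteq> 0}"
  by (rule finite_support_affine[OF finite_support_T0]) simp

lemma finite_support_weighted_T1: "finite {j. c j * T1 L (6 * j + a) \<noteq> 0}"
  by (rule finite_support_affine[OF finite_support_T1]) simp

lemma U_sum_split:
  "U_sum L = Sum_any (\<lambda>j. x powi (12 * j ^ 2 + 6 * j) * T0 x L (6 * j + 1))
     + Sum_any (\<lambda>j. x powi (12 * j ^ 2 + 6 * j) * T0 x L (6 * j + 2))"
  unfolding U_sum_def U_def distrib_left
  by (subst Sum_any.distrib[OF finite_support_weighted_T0 finite_support_weighted_T0, symmetric])
    (simp add: add.assoc)

lemma U_companion_split: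
  "U_companion L = Sum_any (\<lambda>j. x powi (12 * j ^ 2) * T1 L (6 * j + 0))
     + Sum_any (\<lambda>j. x powi (12 * j ^ 2 + 12 * j + 3) * T1 L (6 * j + 3))"
  unfolding U_companion_def
  by (subst Sum_any.distrib[OF finite_support_weighted_T1 finite_support_weighted_T1, symmetric]) simp

text \<open>
  For the second equation, \<open>T1_Suc\<close> yields \<open>T\<^sub>0\<close> at \<open>6j + 1\<close> and \<open>6j - 1\<close> from the even part of the
  companion, and at \<open>6j + 4\<close> and \<open>6j + 2\<close> from the odd part. By the symmetry of \<open>T\<^sub>0\<close>,
  \<open>6j - 1\<close> reflects to \<open>6j + 1\<close> under \<open>j \<mapsto> -j\<close> and \<open>6j + 4\<close> to \<open>6j + 2\<close> under \<open>j \<mapsto> -j-1\<close>, always with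
  exponent \<open>12j\<^sup>2 + 6j\<close>; so each half of the sum over \<open>U\<close> occurs twice.
\<close>
lemma U_system:
  "U_sum (Suc L) = (1 + x ^ (2 * L + 1)) * U_sum L + x ^ L * U_companion L"
  "U_companion (Suc L) = U_companion L + 2 * x ^ Suc L * U_sum L"
proof -
  have fU: "finite {j. x powi (12 * j ^ 2 + 6 * j) * U x L (6 * j + 1) \<noteq> 0}"
  proof (rule finite_support_affine)
    show "finite {A. U x L A \<noteq> 0}"
    proof (rule finite_subset)
      have "U x L A = 0" if "\<bar>A\<bar> > int L + 1" for A
        using that by (simp add: U_def T0_eq_0)
      then show "{A. U x L A \<noteq> 0} \<subseteq> {- int L - 1..int L + 1}" by force
    qed simp
  qed simp
  note fT = finite_support_weighted_T1
  have "U_sum (Suc L) = Sum_any (\<lambda>j. (1 + x ^ (2 * L + 1)) * (x powi (12 * j ^ 2 + 6 * j) * U x L (6 * j + 1))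
      + x ^ L * (x powi (12 * j ^ 2) * T1 L (6 * j + 0))
      + x ^ L * (x powi (12 * j ^ 2 + 12 * j + 3) * T1 L (6 * j + 3)))"
    unfolding U_sum_def
  proof (rule Sum_any.cong)
    fix j :: int
    have "x powi (12 * j ^ 2 + 6 * j) * x powi (1 - (6 * j + 1)) = x powi (12 * j ^ 2)"
      "x powi (12 * j ^ 2 + 6 * j) * x powi (6 * j + 1 + 2) = x powi (12 * j ^ 2 + 12 * j + 3)"
      by (simp_all add: power_int_add[symmetric] nonzero algebra_simps)
    note e = this[symmetric]
    show "x powi (12 * j ^ 2 + 6 * j) * U x (Suc L) (6 * j + 1)
      = (1 + x ^ (2 * L + 1)) * (x powi (12 * j ^ 2 + 6 * j) * U x L (6 * j + 1))
      + x ^ L * (x powi (12 * j ^ 2) * T1 L (6 * j + 0))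
      + x ^ L * (x powi (12 * j ^ 2 + 12 * j + 3) * T1 L (6 * j + 3))"
      unfolding U_Suc e by (simp add: algebra_simps)
  qed
  also have "\<dots> = (1 + x ^ (2 * L + 1)) * U_sum L + x ^ L * U_companion L"
    unfolding Sum_any_linear[OF fU fT fT] U_companion_split U_sum_def by (simp add: algebra_simps)
  finally show "U_sum (Suc L) = (1 + x ^ (2 * L + 1)) * U_sum L + x ^ L * U_companion L" .

  note f0 = finite_support_weighted_T0
  let ?A = "\<lambda>a. Sum_any (\<lambda>j. x powi (12 * j ^ 2 + 6 * j) * T0 x L (6 * j + a))"
  have "Sum_any (\<lambda>j. x powi (12 * j ^ 2) * T1 (Suc L) (6 * j + 0))
     = Sum_any (\<lambda>j. 1 * (x powi (12 * j ^ 2) * T1 L (6 * j + 0))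
        + x ^ Suc L * (x powi (12 * j ^ 2 + 6 * j) * T0 x L (6 * j + 1))
        + x ^ Suc L * (x powi (12 * j ^ 2 - 6 * j) * T0 x L (6 * j + (-1))))"
  proof (rule Sum_any.cong)
    fix j :: int
    have "x powi (12 * j ^ 2) * x powi (6 * j) = x powi (12 * j ^ 2 + 6 * j)"
      "x powi (12 * j ^ 2) * x powi (- (6 * j)) = x powi (12 * j ^ 2 - 6 * j)"
      by (simp_all add: power_int_add[symmetric] nonzero algebra_simps)
    note e = this[symmetric]
    show "x powi (12 * j ^ 2) * T1 (Suc L) (6 * j + 0) = 1 * (x powi (12 * j ^ 2) * T1 L (6 * j + 0))
        + x ^ Suc L * (x powi (12 * j ^ 2 + 6 * j) * T0 x L (6 * j + 1))
        + x ^ Suc L * (x powi (12 * j ^ 2 - 6 * j) * T0 x L (6 * j + (-1)))"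
      unfolding T1_Suc e by (simp add: algebra_simps)
  qed
  moreover have "Sum_any (\<lambda>j. x powi (12 * j ^ 2 - 6 * j) * T0 x L (6 * j + (-1))) = ?A 1"
  proof (subst Sum_any_flip[of _ 0, symmetric], rule Sum_any.cong)
    fix j :: int
    show "x powi (12 * (- j - 0)\<^sup>2 - 6 * (- j - 0)) * T0 x L (6 * (- j - 0) + - 1) =
         x powi (12 * j\<^sup>2 + 6 * j) * T0 x L (6 * j + 1)"
      using T0_sym[of L "6 * j + 1"] by (simp add: algebra_simps)
  qed
  ultimately have 1: "Sum_any (\<lambda>j. x powi (12 * j ^ 2) * T1 (Suc L) (6 * j + 0))
     = Sum_any (\<lambda>j. x powi (12 * j ^ 2) * T1 L (6 * j + 0)) + 2 * x ^ Suc L * ?A 1"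
    unfolding Sum_any_linear[OF fT f0 f0] by (simp del: power_Suc)
  have "Sum_any (\<lambda>j. x powi (12 * j ^ 2 + 12 * j + 3) * T1 (Suc L) (6 * j + 3))
     = Sum_any (\<lambda>j. 1 * (x powi (12 * j ^ 2 + 12 * j + 3) * T1 L (6 * j + 3))
        + x ^ Suc L * (x powi (12 * j ^ 2 + 18 * j + 6) * T0 x L (6 * j + 4))
        + x ^ Suc L * (x powi (12 * j ^ 2 + 6 * j) * T0 x L (6 * j + 2)))"
  proof (rule Sum_any.cong)
    fix j :: int
    have "x powi (12 * j ^ 2 + 12 * j + 3) * x powi (6 * j + 3) = x powi (12 * j ^ 2 + 18 * j + 6)"
      "x powi (12 * j ^ 2 + 12 * j + 3) * x powi (- (6 * j + 3)) = x powi (12 * j ^ 2 + 6 * j)"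
      by (simp_all add: power_int_add[symmetric] nonzero algebra_simps)
    note e = this[symmetric]
    show "x powi (12 * j ^ 2 + 12 * j + 3) * T1 (Suc L) (6 * j + 3)
     = 1 * (x powi (12 * j ^ 2 + 12 * j + 3) * T1 L (6 * j + 3))
        + x ^ Suc L * (x powi (12 * j ^ 2 + 18 * j + 6) * T0 x L (6 * j + 4))
        + x ^ Suc L * (x powi (12 * j ^ 2 + 6 * j) * T0 x L (6 * j + 2))"
      unfolding T1_Suc e by (simp add: algebra_simps)
  qed
  moreover have "Sum_any (\<lambda>j. x powi (12 * j ^ 2 + 18 * j + 6) * T0 x L (6 * j + 4)) = ?A 2"
  proof (subst Sum_any_flip[of _ 1, symmetric], rule Sum_any.cong)
    fix j :: int
    show "x powi (12 * (- j - 1)\<^sup>2 + 18 * (- j - 1) + 6) * T0 x L (6 * (- j - 1) + 4) =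
         x powi (12 * j\<^sup>2 + 6 * j) * T0 x L (6 * j + 2)"
      using T0_sym[of L "6 * j + 2"] by (simp add: algebra_simps power2_eq_square)
  qed
  ultimately have 2: "Sum_any (\<lambda>j. x powi (12 * j ^ 2 + 12 * j + 3) * T1 (Suc L) (6 * j + 3))
     = Sum_any (\<lambda>j. x powi (12 * j ^ 2 + 12 * j + 3) * T1 L (6 * j + 3)) + 2 * x ^ Suc L * ?A 2"
    unfolding Sum_any_linear[OF fT f0 f0] by (simp del: power_Suc)
  show "U_companion (Suc L) = U_companion L + 2 * x ^ Suc L * U_sum L"
    unfolding U_companion_split 1 2 U_sum_split by (simp add: algebra_simps)
qed

section \<open>Solving the common system\<close>

lemma system_solutions_eq:
  fixes s z s' z' :: "nat \<Rightarrow> 'a"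
  assumes "\<And>L. s (Suc L) = (1 + x ^ (2 * L + 1)) * s L + x ^ L * z L"
    and "\<And>L. z (Suc L) = z L + 2 * x ^ Suc L * s L"
    and "\<And>L. s' (Suc L) = (1 + x ^ (2 * L + 1)) * s' L + x ^ L * z' L"
    and "\<And>L. z' (Suc L) = z' L + 2 * x ^ Suc L * s' L"
    and "s 0 = s' 0" "z 0 = z' 0"
  shows "s L = s' L"
proof -
  have "s L = s' L \<and> z L = z' L"
    using assms by (induction L) (simp_all only: simp_thms)
  then show ?thesis ..
qed

lemma system_second_order:
  fixes s z :: "nat \<Rightarrow> 'a"
  assumes s: "\<And>L. s (Suc L) = (1 + x ^ (2 * L + 1)) * s L + x ^ L * z L"
    and z: "\<And>L. z (Suc L) = z L + 2 * x ^ Suc L * s L"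
  shows "s (Suc (Suc L)) = (1 + x + x ^ (2 * L + 3)) * s (Suc L) + (x ^ (2 * L + 2) - x) * s L"
proof -
  have e: "x ^ L * z L = s (Suc L) - (1 + x ^ (2 * L + 1)) * s L"
    using s[of L] by simp
  have "s (Suc (Suc L)) = (1 + x ^ (2 * Suc L + 1)) * s (Suc L) + x ^ Suc L * z (Suc L)"
    by (rule s)
  also have "x ^ Suc L * z (Suc L) = x * (x ^ L * z L) + 2 * (x ^ Suc L * x ^ Suc L) * s L"
    by (simp add: z algebra_simps)
  also have "x ^ Suc L * x ^ Suc L = x ^ (2 * L + 2)" by (simp flip: power_add add: mult_2)
  finally show ?thesis unfolding e
    by (simp add: algebra_simps numeral_3_eq_3)
qed

lemma central_0: "central 0 A = (if A = 0 then 1 else 0)"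
  by (cases A "0 :: int" rule: linorder_cases) (simp_all add: central_def gauss_n_0 gauss_eq_0)

lemma alt_sum_0: "alt_sum 0 1 4 = 0" "alt_companion 0 = 1"
proof -
  have "3 * j + 1 \<noteq> 0" for j :: int by presburger
  then have z: "alt_sum 0 1 t = 0" for t by (simp add: alt_sum_def central_0)
  then show "alt_sum 0 1 4 = 0" .
  have "alt_sum 0 0 1 = (\<Sum>j\<in>{0}. (-1) powi j * x powi (6 * j ^ 2 + 1 * j) * central 0 (3 * j + 0))"
    unfolding alt_sum_def by (rule Sum_any.expand_superset) (auto simp: central_0)
  then show "alt_companion 0 = 1" by (simp add: z alt_companion_def central_0)
qed

lemma U_sum_0: "U_sum 0 = 0" "U_companion 0 = 1"
proof -
  have "6 * j + 1 \<noteq> 0" "6 * j + 2 \<noteq> 0" "6 * j + 3 \<noteq> 0" for j :: int by presburger+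
  note z = this
  show "U_sum 0 = 0"
    by (simp add: U_sum_split T0_alt_conv alt_conv_0 central_0 z)
  have "U_companion 0 = (\<Sum>j\<in>{0}. x powi (12 * j ^ 2) * T1 0 (6 * j)
      + x powi (12 * j ^ 2 + 12 * j + 3) * T1 0 (6 * j + 3))"
    unfolding U_companion_def
    by (rule Sum_any.expand_superset) (auto simp: T1_def alt_conv_0 central_0 z split: if_splits)
  then show "U_companion 0 = 1" by (simp add: T1_def alt_conv_0 central_0)
qed

lemma U_sum_eq_alt_sum: "U_sum L = alt_sum L 1 4"
  by (rule system_solutions_eq[OF U_system alt_sum_system]) (simp_all add: U_sum_0 alt_sum_0)

section \<open>The double sum\<close>

definition P_row :: "nat \<Rightarrow> nat \<Rightarrow> 'a" where
  "P_row n j = (\<Sum>k\<le>j. x ^ (j ^ 2 + 2 * j + k ^ 2) * gauss_poly (x ^ 2) (int j) (int k)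
     * gauss_poly x (int n + int j - int k + 1) (2 * int j + 1))"

lemma P_row_eq_0: "n < j \<Longrightarrow> P_row n j = 0"
  unfolding P_row_def by (rule sum.neutral) (auto simp: gauss_eq_0)

lemma power_mult_powi: "int M + k = int N \<Longrightarrow> x ^ M * x powi k = x ^ N"
  by (metis power_int_of_nat powi_split)

lemma P_row_rec_0: "P_row (n + 2) 0 - (1 + x) * P_row (n + 1) 0 + x * P_row n 0 = 0"
  using gauss_second_difference[of "int n + 3" 1] generic_base.gauss_n_0[OF generic_base_square, of 0]
  by (simp add: P_row_def gauss_eq_0 algebra_simps)

text \<open>
  The coefficient of \<open>z\<^bsup>n+2\<^esup>\<close> in \<open>(1-z)(1-xz) F\<^bsub>j+1\<^esub>(z) = x\<^sup>3 z (1+xz) F\<^sub>j(x\<^sup>2 z)\<close>, where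
  \<open>F\<^sub>j(z) = \<Sum>\<^sub>n P_row n j z\<^sup>n\<close>. On the inner sums, \<open>(1-z)(1-xz)\<close> acts by
  \<open>gauss_second_difference\<close>, and the Pascal rule for \<open>[j+1, k]\<close> in base \<open>x\<^sup>2\<close> splits off the factor
  \<open>1+xz\<close>.
\<close>
lemma P_row_rec:
  "P_row (n + 2) (Suc j) - (1 + x) * P_row (n + 1) (Suc j) + x * P_row n (Suc j)
     = x ^ (2 * n + 5) * P_row (n + 1) j + x ^ (2 * n + 4) * P_row n j"
proof -
  let ?e = "\<lambda>k. (Suc j) ^ 2 + 2 * Suc j + k ^ 2"
  let ?G = "\<lambda>k. gauss_poly (x ^ 2) (int (Suc j)) (int k)"
  let ?H = "\<lambda>k. x powi (2 * (int n - int j - int k + 1)) * gauss_poly x (int n + int j - int k + 2) (2 * int j + 1)"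
  have d: "gauss_poly x (int (n + 2) + int (Suc j) - int k + 1) (2 * int (Suc j) + 1)
     - (1 + x) * gauss_poly x (int (n + 1) + int (Suc j) - int k + 1) (2 * int (Suc j) + 1)
     + x * gauss_poly x (int n + int (Suc j) - int k + 1) (2 * int (Suc j) + 1) = ?H k"
    if "k \<le> Suc j" for k
    using gauss_second_difference[of "int n + int j - int k + 4" "2 * int j + 3"] that
    by (simp add: algebra_simps)
  have "P_row (n + 2) (Suc j) - (1 + x) * P_row (n + 1) (Suc j) + x * P_row n (Suc j)
     = (\<Sum>k\<le>Suc j. x ^ ?e k * ?G k
         * (gauss_poly x (int (n + 2) + int (Suc j) - int k + 1) (2 * int (Suc j) + 1)
     - (1 + x) * gauss_poly x (int (n + 1) + int (Suc j) - int k + 1) (2 * int (Suc j) + 1)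
     + x * gauss_poly x (int n + int (Suc j) - int k + 1) (2 * int (Suc j) + 1)))"
    unfolding P_row_def sum_distrib_left sum_subtractf[symmetric] sum.distrib[symmetric]
    by (rule sum.cong[OF refl])
      (simp only: distrib_left right_diff_distrib distrib_right left_diff_distrib mult_ac mult_1_left)
  \<comment> \<open>The trivial sign brings the sum into the form of \<open>alt_conv_split\<close> with weight \<open>w = -1\<close>.\<close>
  also have "\<dots> = (\<Sum>k\<le>Suc j. (- (- 1)) ^ k * (x ^ ?e k * ?G k * ?H k))"
    by (rule sum.cong[OF refl]) (simp only: d atMost_iff minus_minus power_one mult_1_left)
  also have "\<dots> = (\<Sum>k\<le>j. (- (- 1)) ^ k * gauss_poly (x ^ 2) (int j) (int k) * ((x ^ 2) ^ k * (x ^ ?e k * ?H k)))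
     - (- 1) * (\<Sum>k\<le>j. (- (- 1)) ^ k * gauss_poly (x ^ 2) (int j) (int k) * (x ^ ?e (Suc k) * ?H (Suc k)))"
    using generic_base.gauss_pascal[OF generic_base_square, of "int (Suc j)" "int _"]
    by (intro alt_conv_split[where k = "\<lambda>k. x ^ ?e k * ?H k"]) (simp add: algebra_simps)
  also have "(\<Sum>k\<le>j. (- (- 1)) ^ k * gauss_poly (x ^ 2) (int j) (int k) * ((x ^ 2) ^ k * (x ^ ?e k * ?H k)))
     = x ^ (2 * n + 5) * P_row (n + 1) j"
    unfolding P_row_def sum_distrib_left
  proof (rule sum.cong[OF refl])
    fix k
    have "(x ^ 2) ^ k * x ^ ?e k * x powi (2 * (int n - int j - int k + 1)) = x ^ (2 * n + 5 + (j ^ 2 + 2 * j + k ^ 2))"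
      unfolding power_mult[symmetric] power_add[symmetric]
      by (rule power_mult_powi) (simp add: power2_eq_square algebra_simps)
    then have e: "(x ^ 2) ^ k * (x ^ ?e k * ?H k) = x ^ (2 * n + 5) * x ^ (j ^ 2 + 2 * j + k ^ 2)
      * gauss_poly x (int n + int j - int k + 2) (2 * int j + 1)"
      by (simp only: power_add mult.assoc[symmetric])
    show "(- (- 1)) ^ k * gauss_poly (x ^ 2) (int j) (int k) * ((x ^ 2) ^ k * (x ^ ?e k * ?H k))
      = x ^ (2 * n + 5) * (x ^ (j ^ 2 + 2 * j + k ^ 2) * gauss_poly (x ^ 2) (int j) (int k)
         * gauss_poly x (int (n + 1) + int j - int k + 1) (2 * int j + 1))"
      unfolding e by (simp add: algebra_simps)
  qed
  also have "(\<Sum>k\<le>j. (- (- 1)) ^ k * gauss_poly (x ^ 2) (int j) (int k) * (x ^ ?e (Suc k) * ?H (Suc k)))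
     = x ^ (2 * n + 4) * P_row n j"
    unfolding P_row_def sum_distrib_left
  proof (rule sum.cong[OF refl])
    fix k
    have "x ^ ?e (Suc k) * x powi (2 * (int n - int j - int (Suc k) + 1)) = x ^ (2 * n + 4 + (j ^ 2 + 2 * j + k ^ 2))"
      by (rule power_mult_powi) (simp add: power2_eq_square algebra_simps)
    then have e: "x ^ ?e (Suc k) * ?H (Suc k) = x ^ (2 * n + 4) * x ^ (j ^ 2 + 2 * j + k ^ 2)
      * gauss_poly x (int n + int j - int (Suc k) + 2) (2 * int j + 1)"
      by (simp only: power_add mult.assoc[symmetric])
    show "(- (- 1)) ^ k * gauss_poly (x ^ 2) (int j) (int k) * (x ^ ?e (Suc k) * ?H (Suc k))
      = x ^ (2 * n + 4) * (x ^ (j ^ 2 + 2 * j + k ^ 2) * gauss_poly (x ^ 2) (int j) (int k)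
         * gauss_poly x (int n + int j - int k + 1) (2 * int j + 1))"
      unfolding e by (simp add: algebra_simps)
  qed
  finally show ?thesis by simp
qed

definition P_sum :: "nat \<Rightarrow> 'a" where
  "P_sum n = (\<Sum>j\<le>n. P_row n j)"

lemma P_sum_extend: "n \<le> N \<Longrightarrow> P_sum n = (\<Sum>j\<le>N. P_row n j)"
  unfolding P_sum_def by (rule sum.mono_neutral_left) (auto simp: P_row_eq_0)

lemma P_sum_rec:
  "P_sum (n + 2) = (1 + x + x ^ (2 * n + 5)) * P_sum (n + 1) + (x ^ (2 * n + 4) - x) * P_sum n"
proof -
  have "P_sum (n + 2) - (1 + x) * P_sum (n + 1) + x * P_sum n
     = (\<Sum>j\<le>Suc (n + 1). P_row (n + 2) j - (1 + x) * P_row (n + 1) j + x * P_row n j)"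
    by (subst (1 2 3) P_sum_extend[where N = "Suc (n + 1)"])
      (simp_all add: sum.distrib sum_subtractf sum_distrib_left del: sum.atMost_Suc)
  also have "\<dots> = (\<Sum>j\<le>n + 1. x ^ (2 * n + 5) * P_row (n + 1) j + x ^ (2 * n + 4) * P_row n j)"
    by (simp only: sum.atMost_Suc_shift P_row_rec P_row_rec_0 add_0_left)
  also have "\<dots> = x ^ (2 * n + 5) * P_sum (n + 1) + x ^ (2 * n + 4) * P_sum n"
    by (subst (1 2) P_sum_extend[where N = "n + 1"])
      (simp_all add: sum.distrib sum_distrib_left del: sum.atMost_Suc)
  finally show ?thesis by (simp add: algebra_simps)
qed

lemma gauss_n_1: "gauss_poly x 2 1 = 1 + x"
  using gauss_pascal[of 2 1] by (simp add: gauss_n_0 gauss_n_n)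

lemma P_sum_0: "P_sum 0 = 1"
  using generic_base.gauss_n_0[OF generic_base_square, of 0]
  by (simp add: P_sum_def P_row_def gauss_n_n)

lemma P_sum_1: "P_sum 1 = x ^ 3 + x + 1"
proof -
  have "P_row 1 0 = 1 + x"
    using generic_base.gauss_n_0[OF generic_base_square, of 0] by (simp add: P_row_def gauss_n_1)
  moreover have "P_row 1 1 = x ^ 3"
    using generic_base.gauss_n_0[OF generic_base_square, of 1]
    by (simp add: P_row_def gauss_n_n gauss_eq_0 numeral_3_eq_3)
  ultimately show ?thesis by (simp add: P_sum_def)
qed

lemma alt_sum_1: "alt_sum 1 1 4 = 1"
  using alt_sum_system(1)[of 0] by (simp add: alt_sum_0)

lemma alt_sum_2: "alt_sum 2 1 4 = x ^ 3 + x + 1"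
  using alt_sum_system(1)[of 1] alt_sum_system(2)[of 0]
  by (simp add: alt_sum_0 alt_sum_1[unfolded One_nat_def] numeral_2_eq_2 numeral_3_eq_3)

lemma P_sum_eq_alt_sum: "P_sum n = alt_sum (n + 1) 1 4"
proof (induction n rule: induct_nat_012)
  case 0
  show ?case using P_sum_0 alt_sum_1 by simp
next
  case 1
  show ?case using P_sum_1 alt_sum_2 by (simp add: numeral_2_eq_2)
next
  case (ge2 n)
  have a: "2 * (n + 1) + 3 = 2 * n + 5" "2 * (n + 1) + 2 = 2 * n + 4" by simp_all
  have "alt_sum (Suc (Suc (n + 1))) 1 4
     = (1 + x + x ^ (2 * (n + 1) + 3)) * alt_sum (Suc (n + 1)) 1 4
       + (x ^ (2 * (n + 1) + 2) - x) * alt_sum (n + 1) 1 4"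
    by (rule system_second_order[OF alt_sum_system])
  with ge2 P_sum_rec[of n] show ?case unfolding a by simp
qed

end

section \<open>The indeterminate\<close>

lemma q_power: "q ^ n = Fract (monom 1 n) 1"
  by (induction n) (simp_all add: q_def One_fract_def monom_Suc monom_0 one_pCons[symmetric])

interpretation q: generic_base q
proof
  show "q \<noteq> 0" by (simp add: q_def Zero_fract_def eq_fract)
  show "q ^ n \<noteq> 1" if "n > 0" for n
  proof
    assume "q ^ n = 1"
    then have "monom (1::int) n = 1" by (simp add: q_power One_fract_def eq_fract)
    then have "degree (monom (1::int) n) = 0" by simp
    with that show False by (simp add: degree_monom_eq)
  qed
qed

lemma P_eq_P_sum: "P n = q.P_sum n"
proof -
  have r: "Sum_any (\<lambda>k::nat. q ^ (j ^ 2 + 2 * j + k ^ 2)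
            * gauss_poly (q ^ 2) (int j) (int k)
            * gauss_poly q (int n + int j - int k + 1) (2 * int j + 1)) = q.P_row n j" for j
    unfolding q.P_row_def
    by (rule Sum_any.expand_superset) (auto simp: gauss_poly_def split: if_splits)
  show ?thesis unfolding P_def r q.P_sum_def
    by (rule Sum_any.expand_superset) (use q.P_row_eq_0[of n] in \<open>auto simp: not_le[symmetric]\<close>)
qed

theorem mainTheorem14:
  shows "(\<forall>n::nat.
            P n = Sum_any (\<lambda>j::int. (-1) powi j * q powi (6 * j ^ 2 + 4 * j)
                     * gauss_poly q (2 * int n + 2) (int n + 3 * j + 2))
          \<and> P n = Sum_any (\<lambda>j::int. q powi (12 * j ^ 2 + 6 * j) * U q (n + 1) (6 * j + 1)))
       \<and> P 0 = 1
       \<and> P 1 = q ^ 3 + q + 1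
       \<and> (\<forall>n\<ge>2. P n = (1 + q + q ^ (2 * n + 1)) * P (n - 1) + (q ^ (2 * n) - q) * P (n - 2))"
proof (intro conjI allI impI)
  fix n :: nat
  have "gauss_poly q (2 * int n + 2) (int n + 3 * j + 2) = q.central (n + 1) (3 * j + 1)" for j
    using q.central_sym[of "n + 1" "3 * j + 1"] by (simp add: q.central_def algebra_simps)
  then show "P n = Sum_any (\<lambda>j::int. (-1) powi j * q powi (6 * j ^ 2 + 4 * j)
                     * gauss_poly q (2 * int n + 2) (int n + 3 * j + 2))"
    using q.P_sum_eq_alt_sum[of n] by (simp add: P_eq_P_sum q.alt_sum_def)
  show "P n = Sum_any (\<lambda>j::int. q powi (12 * j ^ 2 + 6 * j) * U q (n + 1) (6 * j + 1))"
    using q.P_sum_eq_alt_sum[of n] q.U_sum_eq_alt_sum[of "n + 1"]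
    by (simp add: P_eq_P_sum q.U_sum_def)
next
  show "P 0 = 1" by (simp add: P_eq_P_sum q.P_sum_0)
  show "P 1 = q ^ 3 + q + 1" by (simp only: P_eq_P_sum q.P_sum_1)
  fix n :: nat
  assume "n \<ge> 2"
  then obtain m where n: "n = m + 2" by (metis add.commute le_Suc_ex)
  have "2 * n + 1 = 2 * m + 5" "2 * n = 2 * m + 4" "n - 1 = m + 1" "n - 2 = m"
    using n by simp_all
  then show "P n = (1 + q + q ^ (2 * n + 1)) * P (n - 1) + (q ^ (2 * n) - q) * P (n - 2)"
    using q.P_sum_rec[of m] by (simp only: P_eq_P_sum n)
qed

end
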